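(* Let $G$ be an infinite, involution free group and let $F$ be a $2$-regular graph with $|V(F)|=|G|$. Then there exists a $G$-regular solution to the Oberwolfach problem $OP(F)$.
   Context: Graphs are simple and without loops, finite or infinite; set theory is ZFC. $V(\Lambda)$ denotes the vertex set of a graph $\Lambda$, and $\mathbb{K}_V$ is the complete graph with vertex set $V$. A graph is $2$-regular if every vertex has degree $2$ (so its components are finite cycles or two-way infinite paths). A group (written additively, not necessarily abelian) is involution free if it has no element of order $2$. For a $2$-regular graph $F$, a solution to $OP(F)$ is a set $\mathcal{C}$ of spanning subgraphs of $\mathbb{K}_V$ (subgraphs with vertex set $V$), where $V$ is a set with $|V|=|V(F)|$, such that each member of $\mathcal{C}$ is isomorphic to $F$ and each edge of $\mathbb{K}_V$ belongs to exactly one member of $\mathcal{C}$. Such a $\mathcal{C}$ is $G$-regular if it admits $G$ as an automorphism group acting sharply transitively on the vertices, i.e. there is a sharply transitive action of $G$ on $V$ such that, for all $g\in G$ and $B\in\mathcal{C}$, the image of $B$ under $g$ belongs to $\mathcal{C}$. *)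

theory Defs
  imports "HOL-Algebra.Algebra" "HOL-Library.Equipollence"
begin

text \<open>Undirected graphs, finite or infinite: a vertex set together with a set of edges, where
  an edge is the set of its two end vertices.\<close>

datatype 'v ugraph = Graph (verts: "'v set") (edges: "'v set set")

definition simple_graph :: "'v ugraph \<Rightarrow> bool" where
  "simple_graph F \<longleftrightarrow> (\<forall>e \<in> edges F. e \<subseteq> verts F \<and> card e = 2)"

definition complete_graph :: "'v set \<Rightarrow> 'v ugraph" where
  "complete_graph V = Graph V {e. e \<subseteq> V \<and> card e = 2}"

definition spanning_subgraph :: "'v ugraph \<Rightarrow> 'v ugraph \<Rightarrow> bool" where
  "spanning_subgraph H K \<longleftrightarrow> verts H = verts K \<and> edges H \<subseteq> edges K"

text \<open>The degree of a vertex of infinite degree is \<open>0\<close> here (junk value of \<^const>\<open>card\<close>); this is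
  harmless for the notion of 2-regularity.\<close>

definition degree :: "'v ugraph \<Rightarrow> 'v \<Rightarrow> nat" where
  "degree F v = card {e \<in> edges F. v \<in> e}"

definition two_regular :: "'v ugraph \<Rightarrow> bool" where
  "two_regular F \<longleftrightarrow> simple_graph F \<and> (\<forall>v \<in> verts F. degree F v = 2)"

definition graph_isomorphic :: "'v ugraph \<Rightarrow> 'w ugraph \<Rightarrow> bool" where
  "graph_isomorphic F H \<longleftrightarrow>
     (\<exists>f. bij_betw f (verts F) (verts H) \<and>
          (\<forall>u \<in> verts F. \<forall>v \<in> verts F. {u, v} \<in> edges F \<longleftrightarrow> {f u, f v} \<in> edges H))"

definition graph_image :: "('v \<Rightarrow> 'w) \<Rightarrow> 'v ugraph \<Rightarrow> 'w ugraph" where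
  "graph_image f B = Graph (f ` verts B) ((`) f ` edges B)"

definition OP_solution :: "'f ugraph \<Rightarrow> 'v set \<Rightarrow> 'v ugraph set \<Rightarrow> bool" where
  "OP_solution F V \<C> \<longleftrightarrow>
     V \<approx> verts F \<and>
     (\<forall>B \<in> \<C>. spanning_subgraph B (complete_graph V) \<and> graph_isomorphic B F) \<and>
     (\<forall>e \<in> edges (complete_graph V). \<exists>!B. B \<in> \<C> \<and> e \<in> edges B)"

definition involution_free :: "('g, 'm) monoid_scheme \<Rightarrow> bool" where
  "involution_free G \<longleftrightarrow> (\<forall>g \<in> carrier G. group.ord G g \<noteq> 2)"

definition sharply_transitive_action ::
    "('g, 'm) monoid_scheme \<Rightarrow> 'v set \<Rightarrow> ('g \<Rightarrow> 'v \<Rightarrow> 'v) \<Rightarrow> bool" where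
  "sharply_transitive_action G V \<phi> \<longleftrightarrow>
     group_action G V \<phi> \<and>
     (\<forall>x \<in> V. \<forall>y \<in> V. \<exists>!g. g \<in> carrier G \<and> \<phi> g x = y)"

definition regular_OP_solution ::
    "('g, 'm) monoid_scheme \<Rightarrow> 'f ugraph \<Rightarrow> 'v set \<Rightarrow> 'v ugraph set \<Rightarrow> bool" where
  "regular_OP_solution G F V \<C> \<longleftrightarrow>
     OP_solution F V \<C> \<and>
     (\<exists>\<phi>. sharply_transitive_action G V \<phi> \<and>
          (\<forall>g \<in> carrier G. \<forall>B \<in> \<C>. graph_image (\<phi> g) B \<in> \<C>))"

end

theory Submission
  imports Defs
begin

text \<open>
  It suffices to find a bijection \<open>f\<close> from the vertices of \<open>F\<close> onto \<open>G\<close> such that every \<open>d \<noteq> \<one>\<close>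
  is \<open>inv (f u) \<otimes> f v\<close> for exactly one ordered pair of adjacent vertices \<open>(u, v)\<close>: the left
  translates of the resulting copy of \<open>F\<close> then form the solution. Such an \<open>f\<close> (a starter) is built
  by transfinite induction of length \<open>|G|\<close>, taking care at each stage of one vertex, one element
  and one difference. As fewer than \<open>|G|\<close> vertices have been placed so far, a given element can be
  hit, and a given difference realised, far away from all of them. The only delicate case is a
  vertex whose two neighbours have already been placed at \<open>a\<close> and \<open>c\<close>. It may be placed at any
  \<open>x\<close> outside a small set, provided that \<open>inv x \<otimes> a \<noteq> inv c \<otimes> x\<close>, which says that \<open>inv c \<otimes> x\<close>
  is not a square root of \<open>inv c \<otimes> a\<close>. In an involution free group no element has so many square
  roots that this would exclude all the remaining \<open>x\<close>.
\<close>

unbundle cardinal_syntax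

section \<open>Sets of smaller cardinality than an infinite set\<close>

text \<open>Comparability of cardinals makes cardinal arithmetic on the well-orders
  \<open>|A|\<close> usable for \<open>\<prec>\<close>.\<close>

lemma lesspoll_iff_card_of_ordLess: "A \<prec> B \<longleftrightarrow> |A| <o |B|"
proof -
  have "|A| <o |B| \<longleftrightarrow> \<not> B \<lesssim> A"
    unfolding lepoll_def by (rule card_of_ordLess[symmetric])
  moreover have "A \<lesssim> B \<or> B \<lesssim> A"
    unfolding lepoll_def card_of_ordLeq by (rule ordLeq_total) (simp_all add: card_of_Well_order)
  ultimately show ?thesis
    using eqpoll_imp_lepoll[OF eqpoll_sym, of A B] lepoll_antisym[of A B]
    unfolding lesspoll_def by blast
qed

lemma image_lesspoll: "A \<prec> B \<Longrightarrow> f ` A \<prec> B"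
  by (meson image_lepoll lesspoll_trans1)

lemma Un_lesspoll_infinite:
  assumes "infinite C" "A \<prec> C" "B \<prec> C" shows "A \<union> B \<prec> C"
  using assms card_of_Un_ordLess_infinite unfolding lesspoll_iff_card_of_ordLess by blast

lemma insert_lesspoll_infinite:
  assumes "infinite C" "A \<prec> C" shows "insert x A \<prec> C"
  using Un_lesspoll_infinite[OF assms(1) finite_lesspoll_infinite[OF assms(1)] assms(2), of "{x}"]
  by simp

text \<open>For infinite \<open>I\<close> the union is bounded by \<open>|I|\<close> itself, so the
  cardinal of \<open>C\<close> may be singular.\<close>

lemma UN_finite_lesspoll_infinite:
  assumes "infinite C" "I \<prec> C" and fin: "\<And>i. i \<in> I \<Longrightarrow> finite (A i)"
  shows "(\<Union>i\<in>I. A i) \<prec> C"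
proof (cases "finite I")
  case True
  then show ?thesis using fin by (intro finite_lesspoll_infinite \<open>infinite C\<close>) auto
next
  case False
  have "|A i| \<le>o |I|" if "i \<in> I" for i
    using fin[OF that] False
    by (metis finite_lesspoll_infinite lesspoll_iff_card_of_ordLess ordLess_imp_ordLeq)
  then have "|\<Union>i\<in>I. A i| \<le>o |I|"
    using False by (intro card_of_UNION_ordLeq_infinite) auto
  then show ?thesis
    using assms(2) ordLeq_ordLess_trans unfolding lesspoll_iff_card_of_ordLess by blast
qed

lemma Times_lesspoll_infinite:
  fixes A :: "'a set" and B :: "'b set"
  assumes "infinite C" "A \<prec> C" "B \<prec> C"
  shows "A \<times> B \<prec> C"
proof (cases "finite (A <+> B)")
  case True
  then show ?thesis by (intro finite_lesspoll_infinite \<open>infinite C\<close>) auto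
next
  case False
  \<comment> \<open>Both factors embed in the disjoint sum, and an infinite set is equipollent to
    its square.\<close>
  have "map_prod Inl Inr ` (A \<times> B) \<subseteq> (A <+> B) \<times> (A <+> B)"
    and "inj_on (map_prod Inl Inr :: _ \<Rightarrow> ('a + 'b) \<times> ('a + 'b)) (A \<times> B)"
    by (auto simp: inj_on_def)
  then have "|A \<times> B| \<le>o |(A <+> B) \<times> (A <+> B)|"
    using card_of_ordLeq by blast
  also have "|(A <+> B) \<times> (A <+> B)| =o |A <+> B|"
    using False by (rule card_of_Times_same_infinite)
  finally have "|A \<times> B| \<le>o |A <+> B|" .
  then show ?thesis
    using card_of_Plus_ordLess_infinite[OF assms(1)] assms(2,3) ordLeq_ordLess_trans
    unfolding lesspoll_iff_card_of_ordLess by blast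
qed

lemma lesspoll_imp_ex_notin:
  assumes "A \<prec> C" obtains x where "x \<in> C" "x \<notin> A"
proof -
  have "\<not> C \<subseteq> A"
    using assms by (meson lesspoll_not_refl lesspoll_trans2 subset_imp_lepoll)
  then show ?thesis using that by blast
qed

section \<open>Transfinite extension\<close>

text \<open>One finite set is added per index along a well-order of type \<open>|I|\<close>, so
  fewer than \<open>|I|\<close> elements are present before each stage. Finite character carries
  \<open>good\<close> through limits, and \<open>mono\<close> keeps requirements satisfied once they
  are met.\<close>

lemma transfinite_extension:
  fixes good :: "'a set \<Rightarrow> bool" and I :: "'i set"
  assumes inf: "infinite I"
    and fin_char: "\<And>p. (\<And>A. finite A \<Longrightarrow> A \<subseteq> p \<Longrightarrow> good A) \<Longrightarrow> good p"
    and down: "\<And>p A. good p \<Longrightarrow> A \<subseteq> p \<Longrightarrow> good A"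
    and empty: "good {}"
    and mono: "\<And>i p q. req i p \<Longrightarrow> p \<subseteq> q \<Longrightarrow> req i q"
    and step: "\<And>i p. i \<in> I \<Longrightarrow> good p \<Longrightarrow> p \<prec> I \<Longrightarrow> \<exists>q. finite q \<and> good (p \<union> q) \<and> req i (p \<union> q)"
  shows "\<exists>p. good p \<and> (\<forall>i\<in>I. req i p)"
proof -
  define r where "r = |I|"
  have co: "Card_order r" and wo: "Well_order r" and Fr: "Field r = I"
    by (simp_all add: r_def card_of_Card_order card_of_Well_order Field_card_of)
  interpret wo_rel r using wo by (simp add: wo_rel_def)
  \<comment> \<open>The choice is meaningful only if a suitable finite set exists;
    \<open>main\<close> proves this by induction, together with the goodness of the earlier
    stages.\<close>
  define H where "H = (\<lambda>h i. SOME q. finite q \<and> good ((\<Union>j\<in>underS i. h j) \<union> q)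
    \<and> req i ((\<Union>j\<in>underS i. h j) \<union> q))"
  define q where "q = wfrec (r - Id) H"
  define U where "U = (\<lambda>i. \<Union>j\<in>underS i. q j)"
  have q_eq: "q i = (SOME Q. finite Q \<and> good (U i \<union> Q) \<and> req i (U i \<union> Q))" for i
  proof -
    have "q i = H (cut q (r - Id) i) i"
      unfolding q_def by (rule wfrec[OF WF])
    moreover have "(\<Union>j\<in>underS i. cut q (r - Id) i j) = U i"
      unfolding U_def by (rule SUP_cong) (auto simp: cut_def underS_def)
    ultimately show ?thesis by (simp add: H_def)
  qed
  define P where "P = (\<lambda>i. U i \<union> q i)"
  have P_mono: "P j \<subseteq> P i" if "(j, i) \<in> r" for i j
  proof (cases "i = j")
    case False
    have "underS j \<subseteq> underS i"
      using that TRANS ANTISYM by (intro Order_Relation.underS_incr) auto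
    moreover have "j \<in> underS i" using that False by (auto simp: underS_def)
    ultimately show ?thesis unfolding P_def U_def by blast
  qed simp
  \<comment> \<open>A finite subset of the union of a nonempty chain lies in one of its members, so
    finite character applies.\<close>
  have good_union: "good (\<Union>(P ` J))" if "J \<subseteq> I" "\<And>j. j \<in> J \<Longrightarrow> good (P j)" for J
  proof (rule fin_char)
    fix A assume A: "finite A" "A \<subseteq> \<Union>(P ` J)"
    show "good A"
    proof (cases "J = {}")
      case False
      have "subset.chain (P ` J) (P ` J)"
      proof -
        have "P i \<subseteq> P j \<or> P j \<subseteq> P i" if "i \<in> J" "j \<in> J" for i j
          using that \<open>J \<subseteq> I\<close> TOTAL P_mono Fr unfolding total_on_def by (metis subsetD order_refl)
        then show ?thesis by (auto simp: subset.chain_def)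
      qed
      then obtain j where "j \<in> J" "A \<subseteq> P j"
        using finite_subset_Union_chain[OF A] False by (metis image_iff image_is_empty)
      then show ?thesis using that(2) down by blast
    qed (use A empty in auto)
  qed
  have main: "finite (q i) \<and> good (P i) \<and> req i (P i)" if "i \<in> I" for i
    using that
  proof (induction i rule: well_order_induct)
    case (1 i)
    have IH: "finite (q j) \<and> good (P j) \<and> req j (P j)" if "j \<in> underS i" for j
      using 1 that Order_Relation.underS_Field[of r i] Fr by (auto simp: underS_def)
    \<comment> \<open>\<open>U i\<close> was defined from the increments alone; as a union of the
      full stages \<open>P j\<close> it becomes the union of a chain of good sets.\<close>
    have U_eq: "U i = \<Union>(P ` underS i)"
    proof
      show "\<Union>(P ` underS i) \<subseteq> U i"
      proof -
        have "underS j \<subseteq> underS i" if "j \<in> underS i" for j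
          using that TRANS ANTISYM by (intro Order_Relation.underS_incr) (auto simp: underS_def)
        then show ?thesis unfolding P_def U_def by blast
      qed
    qed (auto simp: U_def P_def)
    have "good (U i)"
      unfolding U_eq using IH Order_Relation.underS_Field[of r i] Fr by (intro good_union) auto
    moreover have "U i \<prec> I"
      unfolding U_def
    proof (rule UN_finite_lesspoll_infinite[OF inf])
      show "underS i \<prec> I"
        using card_of_underS[OF co] 1(2) Fr unfolding lesspoll_iff_card_of_ordLess r_def by simp
    qed (use IH in auto)
    ultimately have "\<exists>Q. finite Q \<and> good (U i \<union> Q) \<and> req i (U i \<union> Q)"
      using step 1(2) by blast
    then show ?case
      unfolding P_def q_eq[of i] by (rule someI_ex)
  qed
  show ?thesis
    using main good_union[of I] mono by (intro exI[of _ "\<Union>(P ` I)"]) blast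
qed

section \<open>Involution free groups\<close>

lemma (in group) mult_inv_cancel [simp]:
  assumes "a \<in> carrier G" "x \<in> carrier G"
  shows "a \<otimes> (inv a \<otimes> x) = x" "inv a \<otimes> (a \<otimes> x) = x"
  using assms by (simp_all add: m_assoc[symmetric])

lemma (in group) inv_mult_eq_one_iff:
  assumes "a \<in> carrier G" "x \<in> carrier G"
  shows "inv a \<otimes> x = \<one> \<longleftrightarrow> a = x"
proof
  assume "inv a \<otimes> x = \<one>"
  then have "a \<otimes> (inv a \<otimes> x) = a \<otimes> \<one>" by simp
  then show "a = x" using assms by simp
qed (use assms in simp)

lemma (in group) involution_freeD:
  assumes "involution_free G" "x \<in> carrier G" "x \<otimes> x = \<one>"
  shows "x = \<one>"
proof -
  have "x [^] (2::nat) = \<one>" using assms by (simp add: numeral_2_eq_2)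
  then have "ord x dvd 2" using assms by (simp add: pow_eq_id)
  then have "ord x = 1 \<or> ord x = 2" by (metis two_is_prime_nat prime_nat_iff)
  then show ?thesis using assms ord_eq_1 by (auto simp: involution_free_def)
qed

text \<open>If all elements outside \<open>A\<close> were square roots of \<open>c\<close>, one could choose \<open>y\<close> and \<open>z\<close>
  such that \<open>y\<close>, \<open>z\<close>, \<open>y \<otimes> z\<close> and \<open>z \<otimes> y\<close> all are, and these relations force the fourth power
  of \<open>y\<close> to be \<open>\<one>\<close>.\<close>

lemma (in group) ex_square_neq:
  assumes inf: "infinite (carrier G)" and invfree: "involution_free G"
    and A: "A \<subseteq> carrier G" "A \<prec> carrier G" and c: "c \<in> carrier G"
  shows "\<exists>y\<in>carrier G. y \<notin> A \<and> y \<otimes> y \<noteq> c"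
proof (rule ccontr)
  assume "\<not> ?thesis"
  then have sq: "y \<otimes> y = c" if "y \<in> carrier G" "y \<notin> A" for y using that by blast
  \<comment> \<open>Keeping \<open>y\<close> away from \<open>\<one>\<close> supplies the final
    contradiction.\<close>
  obtain y where y: "y \<in> carrier G" "y \<notin> insert \<one> A"
    using lesspoll_imp_ex_notin[OF insert_lesspoll_infinite[OF inf A(2)]] by metis
  \<comment> \<open>For \<open>z\<close> outside these translates of \<open>A\<close>, both
    \<open>y \<otimes> z\<close> and \<open>z \<otimes> y\<close> avoid \<open>A\<close> as
    well.\<close>
  have "A \<union> ((\<lambda>a. inv y \<otimes> a) ` A \<union> (\<lambda>a. a \<otimes> inv y) ` A) \<prec> carrier G"
    using A by (intro Un_lesspoll_infinite inf image_lesspoll)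
  then obtain z where z: "z \<in> carrier G" "z \<notin> A"
    and z1: "z \<notin> (\<lambda>a. inv y \<otimes> a) ` A" and z2: "z \<notin> (\<lambda>a. a \<otimes> inv y) ` A"
    by (rule lesspoll_imp_ex_notin) blast
  have "y \<otimes> z \<notin> A"
  proof
    assume "y \<otimes> z \<in> A"
    moreover have "z = inv y \<otimes> (y \<otimes> z)" using y z by (simp add: m_assoc[symmetric])
    ultimately show False using z1 by blast
  qed
  moreover have "z \<otimes> y \<notin> A"
  proof
    assume "z \<otimes> y \<in> A"
    moreover have "z = (z \<otimes> y) \<otimes> inv y" using y z by (simp add: m_assoc)
    ultimately show False using z2 by blast
  qed
  ultimately have yz: "(y \<otimes> z) \<otimes> (y \<otimes> z) = c" and zy: "(z \<otimes> y) \<otimes> (z \<otimes> y) = c"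
    using sq y z by auto
  have yy: "y \<otimes> y = c" and zz: "z \<otimes> z = c" using sq y z by auto
  have "y \<otimes> (z \<otimes> (y \<otimes> z)) = y \<otimes> y" using yz yy y z by (simp add: m_assoc)
  then have e1: "z \<otimes> (y \<otimes> z) = y" using y z by simp
  have "z \<otimes> (y \<otimes> (z \<otimes> y)) = z \<otimes> z" using zy zz y z by (simp add: m_assoc)
  then have e2: "y \<otimes> (z \<otimes> y) = z" using y z by simp
  \<comment> \<open>Replacing the first \<open>y\<close> of \<open>e2\<close> by means of
    \<open>e1\<close> creates the factor \<open>z \<otimes> z\<close>, which equals
    \<open>y \<otimes> y\<close>; hence \<open>z\<close> is \<open>z\<close> times the fourth power
    of \<open>y\<close>.\<close>
  have "z \<otimes> \<one> = y \<otimes> (z \<otimes> y)" using e2 z by simp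
  also have "\<dots> = (z \<otimes> (y \<otimes> z)) \<otimes> (z \<otimes> y)" using e1 by simp
  also have "\<dots> = z \<otimes> (y \<otimes> ((z \<otimes> z) \<otimes> y))" using y z by (simp add: m_assoc)
  also have "\<dots> = z \<otimes> (y \<otimes> ((y \<otimes> y) \<otimes> y))" by (simp add: yy zz)
  also have "\<dots> = z \<otimes> ((y \<otimes> y) \<otimes> (y \<otimes> y))" using y z by (simp add: m_assoc)
  finally have "\<one> = (y \<otimes> y) \<otimes> (y \<otimes> y)"
    by (rule l_cancel) (use y z in simp_all)
  from involution_freeD[OF invfree _ this[symmetric]] have "y \<otimes> y = \<one>" using y by simp
  from involution_freeD[OF invfree _ this] have "y = \<one>" using y by simp
  then show False using y by simp
qed

section \<open>Partial starters\<close>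

lemma two_regular_edge:
  assumes "two_regular F" "{u, v} \<in> edges F"
  shows "u \<in> verts F" "v \<in> verts F" "u \<noteq> v"
proof -
  have "{u, v} \<subseteq> verts F" "card {u, v} = 2"
    using assms by (auto simp: two_regular_def simple_graph_def)
  then show "u \<in> verts F" "v \<in> verts F" "u \<noteq> v" by auto
qed

lemma two_regular_neighbours:
  assumes F: "two_regular F" and v: "v \<in> verts F"
  obtains a b where "a \<noteq> b" "\<And>w. {w, v} \<in> edges F \<longleftrightarrow> w = a \<or> w = b"
proof -
  have "card {e \<in> edges F. v \<in> e} = 2"
    using F v by (simp add: two_regular_def degree_def)
  then obtain e1 e2 where e: "{e \<in> edges F. v \<in> e} = {e1, e2}" "e1 \<noteq> e2"
    by (auto simp: card_2_iff)
  have other: "\<exists>w. e = {w, v}" if "e \<in> edges F" "v \<in> e" for e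
  proof -
    have "card e = 2" using F that by (auto simp: two_regular_def simple_graph_def)
    then obtain x y where "e = {x, y}" unfolding card_2_iff by blast
    then show ?thesis using that(2) by (auto simp: insert_commute)
  qed
  have e1: "e1 \<in> edges F" "v \<in> e1" and e2: "e2 \<in> edges F" "v \<in> e2" using e(1) by blast+
  obtain a where a: "e1 = {a, v}" using other[OF e1] by blast
  obtain b where b: "e2 = {b, v}" using other[OF e2] by blast
  note ab = a b
  have "{w, v} \<in> edges F \<longleftrightarrow> {w, v} \<in> {e1, e2}" for w unfolding e(1)[symmetric] by simp
  then have "{w, v} \<in> edges F \<longleftrightarrow> w = a \<or> w = b" for w
    unfolding ab by (auto simp: doubleton_eq_iff)
  moreover have "a \<noteq> b" using e(2) ab by auto
  ultimately show ?thesis using that by blast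
qed

text \<open>The set \<open>V\<close> of the theorem stays outside: the construction takes place on
  the group and is carried over to \<open>V\<close> at the end.\<close>

locale infinite_oberwolfach = group G for G :: "('g, 'm) monoid_scheme" (structure) +
  fixes F :: "'f ugraph"
  assumes infinite_G: "infinite (carrier G)"
    and involution_free: "involution_free G"
    and two_regular: "two_regular F"
    and verts_eqpoll: "verts F \<approx> carrier G"
begin

text \<open>A set of pairs \<open>(u, x)\<close> encodes the partial map placing the vertex \<open>u\<close> at \<open>x\<close>. An arc is an
  ordered pair of adjacent placed vertices; injectivity of \<open>diff\<close> on arcs also separates the two
  orientations of one edge.\<close>

definition arcs :: "('f \<times> 'g) set \<Rightarrow> (('f \<times> 'g) \<times> ('f \<times> 'g)) set" where
  "arcs p = {(s, t). s \<in> p \<and> t \<in> p \<and> {fst s, fst t} \<in> edges F}"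

definition diff :: "('f \<times> 'g) \<times> ('f \<times> 'g) \<Rightarrow> 'g" where
  "diff a = inv (snd (fst a)) \<otimes> snd (snd a)"

lemma diff_Pair [simp]: "diff (s, t) = inv (snd s) \<otimes> snd t"
  by (simp add: diff_def)

text \<open>Each difference occurs at most once; that each occurs at least once is a requirement met
  only in the limit.\<close>

definition partial_starter :: "('f \<times> 'g) set \<Rightarrow> bool" where
  "partial_starter p \<longleftrightarrow> p \<subseteq> verts F \<times> carrier G \<and> inj_on fst p \<and> inj_on snd p \<and> inj_on diff (arcs p)"

lemma arcs_mono: "p \<subseteq> q \<Longrightarrow> arcs p \<subseteq> arcs q"
  by (auto simp: arcs_def)

lemma partial_starter_empty: "partial_starter {}"
  by (simp add: partial_starter_def arcs_def)

lemma partial_starter_subset: "partial_starter q \<Longrightarrow> p \<subseteq> q \<Longrightarrow> partial_starter p"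
  unfolding partial_starter_def by (meson arcs_mono inj_on_subset order_trans)

text \<open>A violation involves at most two arcs, hence at most four placed pairs.\<close>

lemma partial_starter_finite_character:
  assumes fin: "\<And>A. finite A \<Longrightarrow> A \<subseteq> p \<Longrightarrow> partial_starter A"
  shows "partial_starter p"
  unfolding partial_starter_def
proof (intro conjI)
  show "p \<subseteq> verts F \<times> carrier G"
  proof
    fix s assume "s \<in> p"
    then show "s \<in> verts F \<times> carrier G" using fin[of "{s}"] by (simp add: partial_starter_def)
  qed
  show "inj_on fst p"
  proof (rule inj_onI)
    fix s t assume st: "s \<in> p" "t \<in> p" "fst s = fst t"
    have "partial_starter {s, t}" using st by (intro fin) auto
    then have "inj_on fst {s, t}" unfolding partial_starter_def by blast
    then show "s = t" using st(3) by (rule inj_onD) auto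
  qed
  show "inj_on snd p"
  proof (rule inj_onI)
    fix s t assume st: "s \<in> p" "t \<in> p" "snd s = snd t"
    have "partial_starter {s, t}" using st by (intro fin) auto
    then have "inj_on snd {s, t}" unfolding partial_starter_def by blast
    then show "s = t" using st(3) by (rule inj_onD) auto
  qed
  show "inj_on diff (arcs p)"
  proof (rule inj_onI)
    fix a b assume ab: "a \<in> arcs p" "b \<in> arcs p" "diff a = diff b"
    let ?A = "{fst a, snd a, fst b, snd b}"
    have "partial_starter ?A" using ab by (intro fin) (auto simp: arcs_def)
    moreover have "a \<in> arcs ?A" "b \<in> arcs ?A" using ab by (auto simp: arcs_def)
    ultimately show "a = b" using ab(3) unfolding partial_starter_def by (meson inj_onD)
  qed
qed

text \<open>The two sides are inverse to each other, so the left one squares to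
  \<open>\<one>\<close>. Thus an arc between distinct elements never has the same difference as its
  reverse.\<close>

lemma inv_eq_of_square:
  assumes "x \<in> carrier G" "a \<in> carrier G" "inv x \<otimes> a = inv a \<otimes> x"
  shows "x = a"
proof -
  have "(inv x \<otimes> a) \<otimes> (inv x \<otimes> a) = (inv x \<otimes> a) \<otimes> (inv a \<otimes> x)" using assms(3) by simp
  also have "\<dots> = \<one>" using assms(1,2) by (simp add: m_assoc)
  finally have "(inv x \<otimes> a) \<otimes> (inv x \<otimes> a) = \<one>" .
  from involution_freeD[OF involution_free _ this] have "inv x \<otimes> a = \<one>" using assms(1,2) by simp
  then show ?thesis using assms(1,2) inv_mult_eq_one_iff by simp
qed

text \<open>Reversing an arc inverts its difference, so freshness has to be checked in one
  orientation only.\<close>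

lemma inv_diff_arcs:
  assumes "partial_starter p" "d \<in> diff ` arcs p"
  shows "inv d \<in> diff ` arcs p"
proof -
  obtain s t where st: "(s, t) \<in> arcs p" "d = inv (snd s) \<otimes> snd t" using assms(2) by auto
  then have "snd s \<in> carrier G" "snd t \<in> carrier G"
    using assms(1) by (auto simp: arcs_def partial_starter_def)
  then have "inv d = diff (t, s)" using st by (simp add: inv_mult_group)
  moreover have "(t, s) \<in> arcs p" using st by (simp add: arcs_def insert_commute)
  ultimately show ?thesis by blast
qed

text \<open>The new arcs leave or enter \<open>v\<close>. Those of the same direction are separated
  by cancellation, leaving ones from entering ones by \<open>two\<close> and, on a single edge, by
  involution freeness; \<open>new\<close> separates all of them from the old arcs.\<close>

lemma partial_starter_insert:
  assumes p: "partial_starter p" and v: "v \<in> verts F" "v \<notin> fst ` p"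
    and x: "x \<in> carrier G" "x \<notin> snd ` p"
    and new: "\<And>s. s \<in> p \<Longrightarrow> {fst s, v} \<in> edges F \<Longrightarrow> inv x \<otimes> snd s \<notin> diff ` arcs p"
    and two: "\<And>s t. s \<in> p \<Longrightarrow> t \<in> p \<Longrightarrow> {fst s, v} \<in> edges F \<Longrightarrow> {fst t, v} \<in> edges F \<Longrightarrow> s \<noteq> t
      \<Longrightarrow> inv x \<otimes> snd s \<noteq> inv (snd t) \<otimes> x"
  shows "partial_starter (insert (v, x) p)"
proof -
  define N where "N = {s \<in> p. {fst s, v} \<in> edges F}"
  define Out where "Out = Pair (v, x) ` N"
  define In where "In = (\<lambda>s. (s, (v, x))) ` N"
  have N: "snd s \<in> carrier G" "s \<in> p" if "s \<in> N" for s
    using that p by (auto simp: N_def partial_starter_def)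
  have inj_snd: "s = t" if "s \<in> N" "t \<in> N" "snd s = snd t" for s t
    using that p N(2) unfolding partial_starter_def by (meson inj_onD)
  have "{v, v} \<notin> edges F" using two_regular_edge(3)[OF two_regular, of v v] by blast
  then have arcs: "arcs (insert (v, x) p) = arcs p \<union> (Out \<union> In)"
    by (auto simp: arcs_def Out_def In_def N_def insert_commute)
  have "diff ` Out \<inter> diff ` arcs p = {}"
  proof -
    have "diff ((v, x), s) \<notin> diff ` arcs p" if "s \<in> N" for s
      using new that by (simp add: N_def)
    then show ?thesis unfolding Out_def by blast
  qed
  moreover have "diff ` In \<inter> diff ` arcs p = {}"
  proof -
    have "inv (snd s) \<otimes> x \<notin> diff ` arcs p" if s: "s \<in> N" for s
    proof
      assume "inv (snd s) \<otimes> x \<in> diff ` arcs p"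
      then have "inv (inv (snd s) \<otimes> x) \<in> diff ` arcs p" using inv_diff_arcs p by blast
      then have "inv x \<otimes> snd s \<in> diff ` arcs p" using N[OF s] x by (simp add: inv_mult_group)
      then show False using new s by (auto simp: N_def)
    qed
    then have "diff (s, (v, x)) \<notin> diff ` arcs p" if "s \<in> N" for s
      using that by simp
    then show ?thesis unfolding In_def by blast
  qed
  moreover have "diff ` Out \<inter> diff ` In = {}"
  proof -
    have "inv x \<otimes> snd s \<noteq> inv (snd t) \<otimes> x" if "s \<in> N" "t \<in> N" for s t
    proof (cases "s = t")
      case True
      then show ?thesis using inv_eq_of_square[OF x(1)] N[OF that(1)] x(2) by blast
    next
      case False
      then show ?thesis using two that by (auto simp: N_def)
    qed
    then show ?thesis by (fastforce simp: Out_def In_def)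
  qed
  moreover have "inj_on diff Out" "inj_on diff In"
    using N x inj_snd by (auto simp: Out_def In_def inj_on_def)
  moreover have "inj_on diff (arcs p)" using p by (simp add: partial_starter_def)
  ultimately have "inj_on diff (arcs (insert (v, x) p))"
    unfolding arcs inj_on_Un by blast
  then show ?thesis
    using p v x by (auto simp: partial_starter_def)
qed

section \<open>Extending a small partial starter by a vertex, an element or a difference\<close>

lemma neighbours_lesspoll:
  assumes "S \<prec> carrier G"
  shows "{v. \<exists>u\<in>S. {u, v} \<in> edges F} \<prec> carrier G"
proof -
  have "finite {v. {u, v} \<in> edges F}" for u
  proof (cases "u \<in> verts F")
    case True
    obtain a b where ab: "\<And>w. {w, u} \<in> edges F \<longleftrightarrow> w = a \<or> w = b"
      using two_regular_neighbours[OF two_regular True] by blast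
    have "{v. {u, v} \<in> edges F} = {a, b}" using ab by (auto simp: insert_commute)
    then show ?thesis by simp
  next
    case False
    then have "{v. {u, v} \<in> edges F} = {}" using two_regular_edge(1)[OF two_regular] by blast
    then show ?thesis by simp
  qed
  then have "(\<Union>u\<in>S. {v. {u, v} \<in> edges F}) \<prec> carrier G"
    by (intro UN_finite_lesspoll_infinite infinite_G assms)
  moreover have "(\<Union>u\<in>S. {v. {u, v} \<in> edges F}) = {v. \<exists>u\<in>S. {u, v} \<in> edges F}" by auto
  ultimately show ?thesis by simp
qed

lemma ex_vert_notin:
  assumes "S \<prec> carrier G" obtains v where "v \<in> verts F" "v \<notin> S"
  using lesspoll_eq_trans[OF assms eqpoll_sym[OF verts_eqpoll]] by (rule lesspoll_imp_ex_notin)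

lemma extend_vertex:
  assumes p: "partial_starter p" "p \<prec> carrier G" and v: "v \<in> verts F"
  shows "\<exists>q. finite q \<and> partial_starter (p \<union> q) \<and> v \<in> fst ` (p \<union> q)"
proof (cases "v \<in> fst ` p")
  case True
  then show ?thesis using p by (intro exI[of _ "{}"]) auto
next
  case False
  \<comment> \<open>\<open>T\<close> contains every position \<open>x\<close> for which some
    \<open>inv (snd s) \<otimes> x\<close> is an old difference; the triples
    \<open>(s, s, s)\<close> contribute the elements already used.\<close>
  define T where "T = (\<lambda>(s, t, u). snd s \<otimes> (inv (snd t) \<otimes> snd u)) ` (p \<times> p \<times> p)"
  have pc: "snd s \<in> carrier G" if "s \<in> p" for s using that p by (auto simp: partial_starter_def)
  have T: "T \<subseteq> carrier G" using pc by (auto simp: T_def)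
  have T_less: "T \<prec> carrier G"
    unfolding T_def by (intro image_lesspoll Times_lesspoll_infinite infinite_G p)
  have ran_T: "snd ` p \<subseteq> T"
  proof
    fix x assume "x \<in> snd ` p"
    then obtain s where s: "s \<in> p" "x = snd s" by auto
    then have "x = snd s \<otimes> (inv (snd s) \<otimes> snd s)" using pc by simp
    then show "x \<in> T" unfolding T_def using s by (intro image_eqI[of _ _ "(s, s, s)"]) auto
  qed
  have new: "inv x \<otimes> snd s \<notin> diff ` arcs p" if "x \<in> carrier G" "x \<notin> T" "s \<in> p" for x s
  proof
    assume "inv x \<otimes> snd s \<in> diff ` arcs p"
    then have "inv (inv x \<otimes> snd s) \<in> diff ` arcs p" using inv_diff_arcs p by blast
    moreover have "inv (inv x \<otimes> snd s) = inv (snd s) \<otimes> x"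
      using that pc by (simp add: inv_mult_group)
    ultimately obtain t u where tu: "(t, u) \<in> arcs p" "inv (snd s) \<otimes> x = inv (snd t) \<otimes> snd u"
      by auto
    then have "x = snd s \<otimes> (inv (snd t) \<otimes> snd u)" "t \<in> p" "u \<in> p"
      using that pc by (auto simp: arcs_def inv_solve_left')
    then have "x \<in> T" unfolding T_def using that by (intro image_eqI[of _ _ "(s, t, u)"]) auto
    then show False using that by blast
  qed
  obtain a b where ab: "\<And>w. {w, v} \<in> edges F \<longleftrightarrow> w = a \<or> w = b"
    using two_regular_neighbours[OF two_regular v] by blast
  have inj_fst: "s = t" if "s \<in> p" "t \<in> p" "fst s = fst t" for s t
    using that p unfolding partial_starter_def by (meson inj_onD)
  \<comment> \<open>Outside \<open>T\<close>, only a clash between arcs at two different placed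
    neighbours remains to be avoided.\<close>
  have "\<exists>x. x \<in> carrier G \<and> x \<notin> T \<and>
    (\<forall>s\<in>p. \<forall>t\<in>p. {fst s, v} \<in> edges F \<longrightarrow> {fst t, v} \<in> edges F \<longrightarrow> s \<noteq> t
      \<longrightarrow> inv x \<otimes> snd s \<noteq> inv (snd t) \<otimes> x)"
  proof (cases "a \<in> fst ` p \<and> b \<in> fst ` p")
    case True
    then obtain s t where st: "s \<in> p" "fst s = a" "t \<in> p" "fst t = b" by auto
    \<comment> \<open>Substituting \<open>x = snd t \<otimes> y\<close> turns the clash into
      \<open>y \<otimes> y = inv (snd t) \<otimes> snd s\<close>; \<open>A\<close> is
      \<open>T\<close> expressed in terms of \<open>y\<close>.\<close>
    define A where "A = (\<lambda>x. inv (snd t) \<otimes> x) ` T"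
    have "A \<subseteq> carrier G" using T pc[OF st(3)] by (auto simp: A_def)
    moreover have "A \<prec> carrier G" unfolding A_def by (intro image_lesspoll T_less)
    ultimately obtain y where y: "y \<in> carrier G" "y \<notin> A" "y \<otimes> y \<noteq> inv (snd t) \<otimes> snd s"
      using ex_square_neq[OF infinite_G involution_free, of A "inv (snd t) \<otimes> snd s"]
        pc[OF st(1)] pc[OF st(3)] by auto
    define x where "x = snd t \<otimes> y"
    have x: "x \<in> carrier G" "y = inv (snd t) \<otimes> x"
      using y pc st by (auto simp: x_def m_assoc[symmetric])
    have "x \<notin> T" using y(2) x(2) by (auto simp: A_def)
    have neq: "inv x \<otimes> snd s \<noteq> inv (snd t) \<otimes> x"
    proof
      assume "inv x \<otimes> snd s = inv (snd t) \<otimes> x"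
      then have "snd s = x \<otimes> y" using x pc st by (simp add: inv_solve_left')
      then have "inv (snd t) \<otimes> snd s = y \<otimes> y" using x y(1) pc st by (simp add: m_assoc)
      then show False using y(3) by simp
    qed
    \<comment> \<open>The same inequality after inversion, for the two neighbours in the other
      order.\<close>
    have neq': "inv x \<otimes> snd t \<noteq> inv (snd s) \<otimes> x"
    proof
      assume "inv x \<otimes> snd t = inv (snd s) \<otimes> x"
      then have "inv (inv x \<otimes> snd t) = inv (inv (snd s) \<otimes> x)" by simp
      then show False using neq x pc st by (simp add: inv_mult_group)
    qed
    have "(s' = s \<and> t' = t) \<or> (s' = t \<and> t' = s)"
      if "s' \<in> p" "t' \<in> p" "{fst s', v} \<in> edges F" "{fst t', v} \<in> edges F" "s' \<noteq> t'" for s' t'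
      using that st inj_fst unfolding ab by metis
    then show ?thesis using x(1) \<open>x \<notin> T\<close> neq neq' by blast
  next
    case False
    obtain x where x: "x \<in> carrier G" "x \<notin> T" using lesspoll_imp_ex_notin[OF T_less] by blast
    \<comment> \<open>At most one neighbour has been placed, so there is no pair that could
      clash.\<close>
    have "s = t" if "s \<in> p" "t \<in> p" "{fst s, v} \<in> edges F" "{fst t, v} \<in> edges F" for s t
      using that inj_fst False unfolding ab by (metis image_eqI)
    then show ?thesis using x by blast
  qed
  then obtain x where x: "x \<in> carrier G" "x \<notin> T" and two:
    "\<And>s t. s \<in> p \<Longrightarrow> t \<in> p \<Longrightarrow> {fst s, v} \<in> edges F \<Longrightarrow> {fst t, v} \<in> edges F \<Longrightarrow> s \<noteq> t
      \<Longrightarrow> inv x \<otimes> snd s \<noteq> inv (snd t) \<otimes> x" by blast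
  have "partial_starter (insert (v, x) p)"
    using x ran_T by (intro partial_starter_insert p v False new two) auto
  then show ?thesis by (intro exI[of _ "{(v, x)}"]) auto
qed

text \<open>A vertex without placed neighbours may be put on any free element, since no arc is
  created.\<close>

lemma extend_element:
  assumes p: "partial_starter p" "p \<prec> carrier G" and x: "x \<in> carrier G"
  shows "\<exists>q. finite q \<and> partial_starter (p \<union> q) \<and> x \<in> snd ` (p \<union> q)"
proof (cases "x \<in> snd ` p")
  case True
  then show ?thesis using p by (intro exI[of _ "{}"]) auto
next
  case False
  have S: "fst ` p \<prec> carrier G" using p image_lesspoll by blast
  obtain v where v: "v \<in> verts F" "v \<notin> fst ` p \<union> {v. \<exists>u\<in>fst ` p. {u, v} \<in> edges F}"
    using ex_vert_notin[OF Un_lesspoll_infinite[OF infinite_G S neighbours_lesspoll[OF S]]] by blast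
  have "partial_starter (insert (v, x) p)"
    using v False by (intro partial_starter_insert p x) auto
  then show ?thesis by (intro exI[of _ "{(v, x)}"]) auto
qed

text \<open>An edge far from all placed vertices is put at \<open>x\<close> and
  \<open>x \<otimes> d\<close>; it creates exactly the differences \<open>d\<close> and
  \<open>inv d\<close>.\<close>

lemma extend_difference:
  assumes p: "partial_starter p" "p \<prec> carrier G" and d: "d \<in> carrier G" "d \<noteq> \<one>"
  shows "\<exists>q. finite q \<and> partial_starter (p \<union> q) \<and> d \<in> diff ` arcs (p \<union> q)"
proof (cases "d \<in> diff ` arcs p")
  case True
  then show ?thesis using p by (intro exI[of _ "{}"]) auto
next
  case False
  \<comment> \<open>\<open>N\<close> takes closed neighbourhoods. As \<open>v\<close> lies outside
    the second one, its neighbour \<open>w\<close> is neither placed nor adjacent to a placed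
    vertex.\<close>
  define N where "N = (\<lambda>S. S \<union> {v. \<exists>u\<in>S. {u, v} \<in> edges F})"
  have N: "N S \<prec> carrier G" if "S \<prec> carrier G" for S
    unfolding N_def using that neighbours_lesspoll Un_lesspoll_infinite infinite_G by blast
  have "N (N (fst ` p)) \<prec> carrier G" using p image_lesspoll N by blast
  then obtain v where v: "v \<in> verts F" "v \<notin> N (N (fst ` p))" by (rule ex_vert_notin)
  obtain w where w: "{w, v} \<in> edges F"
    using two_regular_neighbours[OF two_regular v(1)] by metis
  have w_vert: "w \<in> verts F" "w \<noteq> v" using two_regular_edge[OF two_regular w] by auto
  have w_notin: "w \<notin> N (fst ` p)" and v_notin: "v \<notin> N (fst ` p)" using v(2) w by (auto simp: N_def)
  \<comment> \<open>The second set keeps \<open>x \<otimes> d\<close> off the used elements.\<close>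
  have "snd ` p \<union> (\<lambda>a. a \<otimes> inv d) ` (snd ` p) \<prec> carrier G"
    by (intro Un_lesspoll_infinite infinite_G image_lesspoll p)
  then obtain x where x: "x \<in> carrier G" "x \<notin> snd ` p" "x \<notin> (\<lambda>a. a \<otimes> inv d) ` (snd ` p)"
    by (rule lesspoll_imp_ex_notin) blast
  have pc: "snd s \<in> carrier G" if "s \<in> p" for s using that p by (auto simp: partial_starter_def)
  have xd: "x \<otimes> d \<notin> snd ` p"
  proof
    assume *: "x \<otimes> d \<in> snd ` p"
    have "x = (x \<otimes> d) \<otimes> inv d" using x(1) d by (simp add: m_assoc)
    then show False using x(3) * by blast
  qed
  have "{v, v} \<notin> edges F" using two_regular_edge(3)[OF two_regular, of v v] by blast
  moreover have "{fst s, v} \<notin> edges F" "{v, fst s} \<notin> edges F" if "s \<in> p" for s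
    using v_notin that by (auto simp: N_def insert_commute)
  ultimately have arcs: "arcs (insert (v, x) p) = arcs p"
    by (auto simp: arcs_def)
  have p1: "partial_starter (insert (v, x) p)"
    using v_notin x(1,2) by (intro partial_starter_insert p v(1)) (auto simp: N_def)
  \<comment> \<open>The arc from \<open>w\<close> back to \<open>v\<close> has difference
    \<open>inv d\<close>, which is fresh because old differences are closed under inversion.\<close>
  have inv_d: "inv d \<notin> diff ` arcs p" using inv_diff_arcs[OF p(1), of "inv d"] False d by auto
  have inv_xd: "inv (x \<otimes> d) \<otimes> x = inv d" using x(1) d by (simp add: inv_mult_group m_assoc)
  have only_v: "s = (v, x)" if "s \<in> insert (v, x) p" "{fst s, w} \<in> edges F" for s
    using that w_notin by (auto simp: N_def)
  have p2: "partial_starter (insert (w, x \<otimes> d) (insert (v, x) p))"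
  proof (rule partial_starter_insert[OF p1 w_vert(1)])
    show "w \<notin> fst ` insert (v, x) p" using w_vert(2) w_notin by (simp add: N_def)
    show "x \<otimes> d \<in> carrier G" using x(1) d by simp
    have "x \<otimes> d \<noteq> x" using x(1) d by simp
    then show "x \<otimes> d \<notin> snd ` insert (v, x) p" using xd by simp
    show "inv (x \<otimes> d) \<otimes> snd s \<notin> diff ` arcs (insert (v, x) p)"
      if "s \<in> insert (v, x) p" "{fst s, w} \<in> edges F" for s
      unfolding only_v[OF that] arcs snd_conv inv_xd by (rule inv_d)
  qed (use only_v in blast)
  have "((v, x), (w, x \<otimes> d)) \<in> arcs (insert (w, x \<otimes> d) (insert (v, x) p))"
    using w by (simp add: arcs_def insert_commute)
  moreover have "diff ((v, x), (w, x \<otimes> d)) = d" using x(1) d by (simp add: m_assoc[symmetric])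
  ultimately have "d \<in> diff ` arcs (insert (w, x \<otimes> d) (insert (v, x) p))" by (rule image_eqI[OF sym, rotated])
  then show ?thesis using p2 by (intro exI[of _ "{(w, x \<otimes> d), (v, x)}"]) auto
qed

section \<open>A starter for the whole graph as the limit of small partial starters\<close>

lemma ex_starter:
  "\<exists>f. bij_betw f (verts F) (carrier G) \<and>
     bij_betw (\<lambda>(u, v). inv (f u) \<otimes> f v) {(u, v). {u, v} \<in> edges F} (carrier G - {\<one>})"
proof -
  \<comment> \<open>\<open>h\<close> indexes the vertices by group elements, so the stage of
    \<open>g\<close> treats the vertex \<open>h g\<close>, the element \<open>g\<close> and, if
    \<open>g \<noteq> \<one>\<close>, the difference \<open>g\<close>.\<close>
  obtain h where h: "bij_betw h (carrier G) (verts F)"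
    using eqpoll_sym[OF verts_eqpoll] unfolding eqpoll_def by blast
  define req where "req = (\<lambda>g p. h g \<in> fst ` p \<and> g \<in> snd ` p \<and> (g \<noteq> \<one> \<longrightarrow> g \<in> diff ` arcs p))"
  have "\<exists>p. partial_starter p \<and> (\<forall>g\<in>carrier G. req g p)"
  proof (rule transfinite_extension[OF infinite_G])
    show "req g q" if "req g p" "p \<subseteq> q" for g p q
      using that arcs_mono[OF that(2)] unfolding req_def by blast
    fix g p assume g: "g \<in> carrier G" and p: "partial_starter p" "p \<prec> carrier G"
    have less: "p \<union> q \<prec> carrier G" if "finite q" "p \<prec> carrier G" for p q :: "('f \<times> 'g) set"
      using Un_lesspoll_infinite[OF infinite_G that(2) finite_lesspoll_infinite[OF infinite_G that(1)]] .
    have "h g \<in> verts F" using h g by (auto simp: bij_betw_def)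
    then obtain q1 where q1: "finite q1" "partial_starter (p \<union> q1)" "h g \<in> fst ` (p \<union> q1)"
      using extend_vertex[OF p] by blast
    obtain q2 where q2: "finite q2" "partial_starter (p \<union> q1 \<union> q2)" "g \<in> snd ` (p \<union> q1 \<union> q2)"
      using extend_element[OF q1(2) less[OF q1(1) p(2)] g] by blast
    obtain q3 where q3: "finite q3" "partial_starter (p \<union> q1 \<union> q2 \<union> q3)"
      "g \<noteq> \<one> \<longrightarrow> g \<in> diff ` arcs (p \<union> q1 \<union> q2 \<union> q3)"
    proof (cases "g = \<one>")
      case True
      then show ?thesis using q2 that[of "{}"] by simp
    next
      case False
      then show ?thesis
        using extend_difference[OF q2(2) less[OF q2(1) less[OF q1(1) p(2)]] g] that by blast
    qed
    have "req g (p \<union> q1 \<union> q2 \<union> q3)"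
      using q1(3) q2(3) q3(3) unfolding req_def by blast
    then show "\<exists>q. finite q \<and> partial_starter (p \<union> q) \<and> req g (p \<union> q)"
      using q1(1) q2(1) q3(1,2) by (intro exI[of _ "q1 \<union> q2 \<union> q3"]) (simp add: Un_assoc)
  qed (use partial_starter_finite_character partial_starter_subset partial_starter_empty in blast)+
  then obtain p where p: "partial_starter p" and req: "\<And>g. g \<in> carrier G \<Longrightarrow> req g p" by blast
  have sub: "p \<subseteq> verts F \<times> carrier G" and inj: "inj_on fst p" "inj_on snd p" "inj_on diff (arcs p)"
    using p by (auto simp: partial_starter_def)
  have dom: "fst ` p = verts F"
  proof
    show "fst ` p \<subseteq> verts F" using sub by auto
    have "h ` carrier G \<subseteq> fst ` p" using req by (auto simp: req_def)
    then show "verts F \<subseteq> fst ` p" using h by (simp add: bij_betw_def)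
  qed
  have ran: "snd ` p = carrier G"
  proof
    show "snd ` p \<subseteq> carrier G" using sub by auto
    show "carrier G \<subseteq> snd ` p" using req unfolding req_def by blast
  qed
  \<comment> \<open>All vertices are placed by now, so \<open>p\<close> is the graph of a function
    on \<open>verts F\<close>.\<close>
  define f where "f = (\<lambda>u. snd (inv_into p fst u))"
  have f_p: "(u, f u) \<in> p" if "u \<in> verts F" for u
  proof -
    have u: "u \<in> fst ` p" using that dom by simp
    have "(u, f u) = inv_into p fst u"
      unfolding f_def by (rule prod_eqI) (simp_all add: f_inv_into_f[OF u])
    then show ?thesis using inv_into_into[OF u] by simp
  qed
  have p_eq: "p = (\<lambda>u. (u, f u)) ` verts F"
  proof
    show "p \<subseteq> (\<lambda>u. (u, f u)) ` verts F"
    proof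
      fix s assume s: "s \<in> p"
      then have u: "fst s \<in> verts F" using sub by auto
      have "s = (fst s, f (fst s))" using inj_onD[OF inj(1) _ s f_p[OF u]] by simp
      then show "s \<in> (\<lambda>u. (u, f u)) ` verts F" using u by blast
    qed
  qed (use f_p in blast)
  have inj_f: "inj_on f (verts F)"
  proof (rule inj_onI)
    fix u v assume uv: "u \<in> verts F" "v \<in> verts F" "f u = f v"
    then show "u = v" using inj_onD[OF inj(2) _ f_p f_p, of u v] by simp
  qed
  have "f ` verts F = carrier G"
  proof -
    have "snd ` (\<lambda>u. (u, f u)) ` verts F = f ` verts F" by (simp add: image_image)
    then show ?thesis using ran p_eq by simp
  qed
  then have bij: "bij_betw f (verts F) (carrier G)" using inj_f by (simp add: bij_betw_def)
  define E where "E = {(u, v). {u, v} \<in> edges F}"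
  have E: "u \<in> verts F" "v \<in> verts F" "u \<noteq> v" if "(u, v) \<in> E" for u v
    using that two_regular_edge[OF two_regular] by (auto simp: E_def)
  have arcs: "arcs p = (\<lambda>(u, v). ((u, f u), (v, f v))) ` E"
  proof -
    have "arcs ((\<lambda>u. (u, f u)) ` verts F) = (\<lambda>(u, v). ((u, f u), (v, f v))) ` E"
      using E by (auto simp: arcs_def E_def)
    then show ?thesis using p_eq by simp
  qed
  have inj_E: "inj_on (\<lambda>(u, v). inv (f u) \<otimes> f v) E"
  proof (rule inj_onI)
    fix a b assume ab: "a \<in> E" "b \<in> E"
      "(\<lambda>(u, v). inv (f u) \<otimes> f v) a = (\<lambda>(u, v). inv (f u) \<otimes> f v) b"
    let ?k = "\<lambda>(u, v). ((u, f u), (v, f v))"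
    have "?k a \<in> arcs p" "?k b \<in> arcs p" unfolding arcs using ab by (simp_all only: imageI)
    moreover have "diff (?k a) = diff (?k b)" using ab(3) by (simp add: case_prod_beta)
    ultimately have "?k a = ?k b" using inj_onD[OF inj(3)] by blast
    then show "a = b" by (simp add: case_prod_beta prod_eq_iff)
  qed
  have "(\<lambda>(u, v). inv (f u) \<otimes> f v) ` E = carrier G - {\<one>}"
  proof
    show "carrier G - {\<one>} \<subseteq> (\<lambda>(u, v). inv (f u) \<otimes> f v) ` E"
    proof
      fix g assume g: "g \<in> carrier G - {\<one>}"
      then have "g \<in> diff ` arcs p" using req by (simp add: req_def)
      then obtain u v where "(u, v) \<in> E" "g = inv (f u) \<otimes> f v" unfolding arcs by auto
      then show "g \<in> (\<lambda>(u, v). inv (f u) \<otimes> f v) ` E" by (intro image_eqI[of _ _ "(u, v)"]) simp_all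
    qed
    have "inv (f u) \<otimes> f v \<in> carrier G - {\<one>}" if "(u, v) \<in> E" for u v
    proof -
      have "f u \<in> carrier G" "f v \<in> carrier G" "f u \<noteq> f v"
        using E[OF that] bij inj_f by (auto simp: bij_betw_def dest: inj_onD)
      moreover from this have "inv (f u) \<otimes> f v \<noteq> \<one>" using inv_mult_eq_one_iff by simp
      ultimately show ?thesis by simp
    qed
    then show "(\<lambda>(u, v). inv (f u) \<otimes> f v) ` E \<subseteq> carrier G - {\<one>}" by auto
  qed
  then show ?thesis using bij inj_E unfolding E_def bij_betw_def by blast
qed

end

section \<open>Regular solutions from starters\<close>

lemma graph_image_isomorphic:
  assumes h: "bij_betw h (verts F) V" and simple: "simple_graph F"
  shows "spanning_subgraph (graph_image h F) (complete_graph V)" "graph_isomorphic (graph_image h F) F"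
proof -
  have inj: "inj_on h (verts F)" and ran: "h ` verts F = V" using h by (auto simp: bij_betw_def)
  have sub: "e \<subseteq> verts F" "card e = 2" if "e \<in> edges F" for e
    using that simple by (auto simp: simple_graph_def)
  have "h ` e \<subseteq> V \<and> card (h ` e) = 2" if "e \<in> edges F" for e
    using sub[OF that] ran by (metis card_image image_mono inj inj_on_subset)
  then show "spanning_subgraph (graph_image h F) (complete_graph V)"
    using ran by (auto simp: spanning_subgraph_def complete_graph_def graph_image_def)
  have "{u, v} \<in> (`) h ` edges F \<longleftrightarrow> inv_into (verts F) h ` {u, v} \<in> edges F"
    if uv: "u \<in> V" "v \<in> V" for u v
  proof
    assume "{u, v} \<in> (`) h ` edges F"
    then obtain e where e: "e \<in> edges F" "{u, v} = h ` e" by blast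
    then show "inv_into (verts F) h ` {u, v} \<in> edges F"
      using inv_into_image_cancel[OF inj sub(1)[OF e(1)]] by simp
  next
    assume "inv_into (verts F) h ` {u, v} \<in> edges F"
    moreover have "h ` inv_into (verts F) h ` {u, v} = {u, v}"
      using uv ran by (intro image_inv_into_cancel) auto
    ultimately show "{u, v} \<in> (`) h ` edges F" by (metis imageI)
  qed
  then show "graph_isomorphic (graph_image h F) F"
    unfolding graph_isomorphic_def
    using bij_betw_inv_into[OF h] ran
    by (intro exI[of _ "inv_into (verts F) h"]) (simp add: graph_image_def)
qed

lemma graph_image_graph_image: "graph_image f (graph_image h B) = graph_image (f \<circ> h) B"
  by (simp add: graph_image_def image_image)

text \<open>The maps of the action are restricted to \<open>V\<close>; as edges are sets of
  vertices, agreement on the vertices is enough.\<close>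

lemma graph_image_cong:
  assumes "simple_graph B" "\<And>u. u \<in> verts B \<Longrightarrow> f u = h u"
  shows "graph_image f B = graph_image h B"
proof -
  have "f ` e = h ` e" if "e \<in> edges B" for e
  proof (rule image_cong)
    fix u assume "u \<in> e"
    then show "f u = h u" using assms that by (auto simp: simple_graph_def)
  qed simp
  then have "(`) f ` edges B = (`) h ` edges B" by (rule image_cong[OF refl])
  moreover have "f ` verts B = h ` verts B" using assms(2) by (intro image_cong) auto
  ultimately show ?thesis by (simp add: graph_image_def)
qed

lemma (in group) bij_betw_mult_left:
  assumes "g \<in> carrier G" shows "bij_betw (\<lambda>x. g \<otimes> x) (carrier G) (carrier G)"
  by (rule bij_betw_byWitness[where f' = "\<lambda>x. inv g \<otimes> x"])
    (use assms in \<open>auto simp: m_assoc[symmetric]\<close>)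

text \<open>This is the left regular action carried to \<open>V\<close> along \<open>b\<close>; the
  restriction makes the maps extensional, as membership in \<open>Bij V\<close> demands.\<close>

lemma (in group) sharply_transitive_transported_action:
  assumes b: "bij_betw b (carrier G) V"
  shows "sharply_transitive_action G V (\<lambda>g. \<lambda>x\<in>V. b (g \<otimes> inv_into (carrier G) b x))"
    (is "sharply_transitive_action G V ?\<phi>")
proof -
  let ?c = "inv_into (carrier G) b"
  have c: "bij_betw ?c V (carrier G)" using b by (rule bij_betw_inv_into)
  have cV: "?c x \<in> carrier G" if "x \<in> V" for x using c that by (auto simp: bij_betw_def)
  have bV: "b g \<in> V" if "g \<in> carrier G" for g using b that by (auto simp: bij_betw_def)
  have cb: "?c (b g) = g" if "g \<in> carrier G" for g using b that by (rule bij_betw_inv_into_left)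
  have bc: "b (?c x) = x" if "x \<in> V" for x using b that by (rule bij_betw_inv_into_right)
  have Bij: "?\<phi> g \<in> Bij V" if g: "g \<in> carrier G" for g
  proof -
    have "bij_betw (b \<circ> ((\<lambda>x. g \<otimes> x) \<circ> ?c)) V V"
      by (rule bij_betw_trans[OF bij_betw_trans[OF c bij_betw_mult_left[OF g]] b])
    then have "bij_betw (?\<phi> g) V V" by (rule bij_betw_cong[THEN iffD1, rotated]) simp
    then show ?thesis by (simp add: Bij_def)
  qed
  have "?\<phi> (g \<otimes> h) = ?\<phi> g \<otimes>\<^bsub>BijGroup V\<^esub> ?\<phi> h" if "g \<in> carrier G" "h \<in> carrier G" for g h
  proof -
    have "?\<phi> g \<otimes>\<^bsub>BijGroup V\<^esub> ?\<phi> h = compose V (?\<phi> g) (?\<phi> h)"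
      using Bij that by (simp add: BijGroup_def)
    also have "\<dots> = ?\<phi> (g \<otimes> h)"
      by (rule ext) (use that cV bV cb in \<open>simp add: compose_def m_assoc\<close>)
    finally show ?thesis by simp
  qed
  then have "?\<phi> \<in> hom G (BijGroup V)"
    using Bij by (auto simp: hom_def BijGroup_def)
  then have "group_action G V ?\<phi>"
    by (simp add: group_action_def group_hom_def group_hom_axioms_def group_BijGroup is_group)
  moreover have "\<exists>!g. g \<in> carrier G \<and> ?\<phi> g x = y" if xy: "x \<in> V" "y \<in> V" for x y
  proof (rule ex1I[of _ "?c y \<otimes> inv (?c x)"])
    show "?c y \<otimes> inv (?c x) \<in> carrier G \<and> ?\<phi> (?c y \<otimes> inv (?c x)) x = y"
      using xy cV bc by (simp add: m_assoc)
    fix g assume g: "g \<in> carrier G \<and> ?\<phi> g x = y"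
    then have "?c y = g \<otimes> ?c x" using xy cV cb by auto
    then show "g = ?c y \<otimes> inv (?c x)" using g xy cV by (simp add: m_assoc)
  qed
  ultimately show ?thesis by (simp add: sharply_transitive_action_def)
qed

theorem theorem3p14:
  fixes G :: "('g, 'm) monoid_scheme" and F :: "'f ugraph" and V :: "'v set"
  assumes "group G"
    and "infinite (carrier G)"
    and "involution_free G"
    and "two_regular F"
    and "verts F \<approx> carrier G"
    and "V \<approx> verts F"
  shows "\<exists>\<C>. regular_OP_solution G F V \<C>"
proof -
  interpret infinite_oberwolfach G F
    using assms by (simp add: infinite_oberwolfach_def infinite_oberwolfach_axioms_def)
  obtain f where f: "bij_betw f (verts F) (carrier G)" and
    diffs: "bij_betw (\<lambda>(u, v). inv\<^bsub>G\<^esub> (f u) \<otimes>\<^bsub>G\<^esub> f v) {(u, v). {u, v} \<in> edges F} (carrier G - {\<one>\<^bsub>G\<^esub>})"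
    using ex_starter by blast
  have "carrier G \<approx> V" using assms(5,6) eqpoll_sym eqpoll_trans by blast
  then obtain b where b: "bij_betw b (carrier G) V" unfolding eqpoll_def by blast
  let ?c = "inv_into (carrier G) b"
  have b_eq: "b g = b h \<longleftrightarrow> g = h" if "g \<in> carrier G" "h \<in> carrier G" for g h
    using b that by (auto simp: bij_betw_def dest: inj_onD)
  have simple: "simple_graph F" using assms(4) by (simp add: two_regular_def)
  have fG: "f u \<in> carrier G" if "u \<in> verts F" for u using f that by (auto simp: bij_betw_def)
  define B where "B g = graph_image (\<lambda>u. b (g \<otimes>\<^bsub>G\<^esub> f u)) F" for g
  let ?\<C> = "B ` carrier G"
  have "bij_betw (b \<circ> ((\<lambda>x. g \<otimes>\<^bsub>G\<^esub> x) \<circ> f)) (verts F) V" if "g \<in> carrier G" for g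
    by (rule bij_betw_trans[OF bij_betw_trans[OF f bij_betw_mult_left[OF that]] b])
  then have bij: "bij_betw (\<lambda>u. b (g \<otimes>\<^bsub>G\<^esub> f u)) (verts F) V" if "g \<in> carrier G" for g
    using that by (simp add: comp_def)
  \<comment> \<open>Edges are unordered, but \<open>(u, v)\<close> can be oriented to match
    \<open>(x, y)\<close>, which brings differences into play.\<close>
  have edge_B: "{b x, b y} \<in> edges (B g) \<longleftrightarrow>
      (\<exists>u v. {u, v} \<in> edges F \<and> x = g \<otimes>\<^bsub>G\<^esub> f u \<and> y = g \<otimes>\<^bsub>G\<^esub> f v)"
    if "x \<in> carrier G" "y \<in> carrier G" "g \<in> carrier G" for x y g
  proof
    assume "{b x, b y} \<in> edges (B g)"
    then obtain e where e: "e \<in> edges F" "{b x, b y} = (\<lambda>u. b (g \<otimes>\<^bsub>G\<^esub> f u)) ` e"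
      by (auto simp: B_def graph_image_def)
    have "card e = 2" using simple e(1) by (simp add: simple_graph_def)
    then obtain u v where uv: "e = {u, v}" unfolding card_2_iff by blast
    have uvF: "u \<in> verts F" "v \<in> verts F" using two_regular_edge[OF assms(4)] e(1) uv by auto
    have "{b x, b y} = {b (g \<otimes>\<^bsub>G\<^esub> f u), b (g \<otimes>\<^bsub>G\<^esub> f v)}" using e(2) uv by simp
    then have "x = g \<otimes>\<^bsub>G\<^esub> f u \<and> y = g \<otimes>\<^bsub>G\<^esub> f v \<or> x = g \<otimes>\<^bsub>G\<^esub> f v \<and> y = g \<otimes>\<^bsub>G\<^esub> f u"
      using that uvF fG by (simp add: doubleton_eq_iff b_eq)
    moreover have "{u, v} \<in> edges F" "{v, u} \<in> edges F" using e(1) uv by (auto simp: insert_commute)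
    ultimately show "\<exists>u v. {u, v} \<in> edges F \<and> x = g \<otimes>\<^bsub>G\<^esub> f u \<and> y = g \<otimes>\<^bsub>G\<^esub> f v" by blast
  next
    assume "\<exists>u v. {u, v} \<in> edges F \<and> x = g \<otimes>\<^bsub>G\<^esub> f u \<and> y = g \<otimes>\<^bsub>G\<^esub> f v"
    then obtain u v where uv: "{u, v} \<in> edges F" "x = g \<otimes>\<^bsub>G\<^esub> f u" "y = g \<otimes>\<^bsub>G\<^esub> f v" by blast
    have "(\<lambda>u. b (g \<otimes>\<^bsub>G\<^esub> f u)) ` {u, v} \<in> edges (B g)"
      using imageI[OF uv(1)] by (simp only: B_def graph_image_def ugraph.sel)
    then show "{b x, b y} \<in> edges (B g)" using uv(2,3) by simp
  qed
  have "\<exists>!B'. B' \<in> ?\<C> \<and> e \<in> edges B'" if e: "e \<in> edges (complete_graph V)" for e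
  proof -
    have "e \<subseteq> V" "card e = 2" using e by (auto simp: complete_graph_def)
    then obtain x' y' where e': "e = {x', y'}" "x' \<noteq> y'" "x' \<in> V" "y' \<in> V"
      unfolding card_2_iff by blast
    have ran: "b ` carrier G = V" using b by (simp add: bij_betw_def)
    obtain x where x: "x \<in> carrier G" "x' = b x" using e'(3) unfolding ran[symmetric] by blast
    obtain y where y: "y \<in> carrier G" "y' = b y" using e'(4) unfolding ran[symmetric] by blast
    have xy: "e = {b x, b y}" "x \<in> carrier G" "y \<in> carrier G" "x \<noteq> y" using e' x y by auto
    \<comment> \<open>With the order of the ends fixed, their difference picks out a unique arc
      \<open>(u, v)\<close>, and \<open>x = g \<otimes> f u\<close> then forces the
      translate.\<close>
    have "inv\<^bsub>G\<^esub> x \<otimes>\<^bsub>G\<^esub> y \<in> carrier G - {\<one>\<^bsub>G\<^esub>}" using xy inv_mult_eq_one_iff by simp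
    then have "inv\<^bsub>G\<^esub> x \<otimes>\<^bsub>G\<^esub> y \<in> (\<lambda>(u, v). inv\<^bsub>G\<^esub> (f u) \<otimes>\<^bsub>G\<^esub> f v) ` {(u, v). {u, v} \<in> edges F}"
      by (simp only: bij_betw_imp_surj_on[OF diffs])
    then obtain u v where uv: "{u, v} \<in> edges F" "inv\<^bsub>G\<^esub> (f u) \<otimes>\<^bsub>G\<^esub> f v = inv\<^bsub>G\<^esub> x \<otimes>\<^bsub>G\<^esub> y"
      by (elim imageE) auto
    have uvG: "f u \<in> carrier G" "f v \<in> carrier G"
      using two_regular_edge[OF assms(4) uv(1)] fG by auto
    define g where "g = x \<otimes>\<^bsub>G\<^esub> inv\<^bsub>G\<^esub> (f u)"
    have g: "g \<in> carrier G" "x = g \<otimes>\<^bsub>G\<^esub> f u" using xy uvG by (simp_all add: g_def m_assoc)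
    have "g \<otimes>\<^bsub>G\<^esub> f v = x \<otimes>\<^bsub>G\<^esub> (inv\<^bsub>G\<^esub> (f u) \<otimes>\<^bsub>G\<^esub> f v)" using xy uvG by (simp add: g_def m_assoc)
    also have "\<dots> = y" unfolding uv(2) using xy by simp
    finally have "e \<in> edges (B g)" unfolding xy(1) edge_B[OF xy(2,3) g(1)] using uv(1) g(2) by blast
    \<comment> \<open>Left translation preserves differences, so any translate containing
      \<open>e\<close> uses the same arc.\<close>
    moreover have "h = g" if h: "h \<in> carrier G" "e \<in> edges (B h)" for h
    proof -
      obtain u' v' where uv': "{u', v'} \<in> edges F" "x = h \<otimes>\<^bsub>G\<^esub> f u'" "y = h \<otimes>\<^bsub>G\<^esub> f v'"
        using h(2) unfolding xy(1) edge_B[OF xy(2,3) h(1)] by blast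
      have uvG': "f u' \<in> carrier G" "f v' \<in> carrier G"
        using two_regular_edge[OF assms(4) uv'(1)] fG by auto
      have "inv\<^bsub>G\<^esub> x \<otimes>\<^bsub>G\<^esub> y = inv\<^bsub>G\<^esub> (f u') \<otimes>\<^bsub>G\<^esub> f v'"
        using uv'(2,3) h(1) uvG' by (simp add: inv_mult_group m_assoc)
      then have "(u, v) = (u', v')"
        by (intro bij_betw_imp_inj_on[OF diffs, THEN inj_onD, of "(u, v)" "(u', v')"])
          (use uv uv'(1) in simp_all)
      then have "h \<otimes>\<^bsub>G\<^esub> f u = x" using uv'(2) by simp
      also have "\<dots> = g \<otimes>\<^bsub>G\<^esub> f u" by (rule g(2))
      finally show ?thesis using h(1) g(1) uvG(1) by simp
    qed
    ultimately show ?thesis using g(1) by blast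
  qed
  moreover have "spanning_subgraph B' (complete_graph V)" "graph_isomorphic B' F" if "B' \<in> ?\<C>" for B'
    using that graph_image_isomorphic[OF bij simple] by (auto simp: B_def)
  ultimately have "OP_solution F V ?\<C>" using assms(6) by (simp add: OP_solution_def)
  \<comment> \<open>Acting by \<open>g\<close> multiplies the translating element on the left, so
    the family is mapped into itself.\<close>
  moreover have "graph_image (\<lambda>x\<in>V. b (g \<otimes>\<^bsub>G\<^esub> ?c x)) (B h) = B (g \<otimes>\<^bsub>G\<^esub> h)"
    if "g \<in> carrier G" "h \<in> carrier G" for g h
    unfolding B_def graph_image_graph_image
  proof (rule graph_image_cong[OF simple])
    fix u assume u: "u \<in> verts F"
    have "b (h \<otimes>\<^bsub>G\<^esub> f u) \<in> V" using bij[OF that(2)] u by (auto simp: bij_betw_def)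
    moreover have "?c (b (h \<otimes>\<^bsub>G\<^esub> f u)) = h \<otimes>\<^bsub>G\<^esub> f u"
      using that fG[OF u] by (intro bij_betw_inv_into_left[OF b]) simp
    ultimately show "((\<lambda>x\<in>V. b (g \<otimes>\<^bsub>G\<^esub> ?c x)) \<circ> (\<lambda>u. b (h \<otimes>\<^bsub>G\<^esub> f u))) u = b (g \<otimes>\<^bsub>G\<^esub> h \<otimes>\<^bsub>G\<^esub> f u)"
      using that fG[OF u] by (simp add: m_assoc)
  qed
  then have "\<forall>g\<in>carrier G. \<forall>B'\<in>?\<C>. graph_image (\<lambda>x\<in>V. b (g \<otimes>\<^bsub>G\<^esub> ?c x)) B' \<in> ?\<C>"
    by auto
  ultimately show ?thesis
    using sharply_transitive_transported_action[OF b] unfolding regular_OP_solution_def by blast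
qed

end
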